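(* Let $K(v,3)$ (with $v\ge 6$) be the Kneser graph on $n=\binom v3$ vertices, and let $k$ and $m_i$ ($i=1,\ldots,k$) be positive integers such that $\sum_{i=1}^k m_i=n$. Then the semidefinite programming bound $\mathrm{GPP}_{\mathrm m}$ for the minimum graph partition problem of $K(v,3)$ is equal to the optimal value of the linear programming problem $$\begin{array}{ll}\min & \frac12\binom v3\binom{v-3}{3}(1-y_3)\\ \text{s.t.} & A_{eq}\,y=b_{eq}\\ & A_{neq}\,y\ge b_{neq}\\ & y\ge 0,\ y=(y_1,y_2,y_3)^{\mathrm T}\in\mathbb R^3,\end{array}$$ where $$A_{eq}=\Big(3(v-3),\ 3\tbinom{v-3}{2},\ \tbinom{v-3}{3}\Big),\qquad A_{neq}=\begin{pmatrix}2v-9&\frac12(v^2-13v+36)&\frac12(-v^2+9v-20)\\ v-7&-2v+11&v-5\\ -3&3&-1\end{pmatrix},$$ $$b_{eq}=\frac1n\sum_{i=1}^k m_i^2-1,\qquad b_{neq}=-(1,1,1)^{\mathrm T}.$$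
   Context: Let $\Omega$ be a set of size $v$ and let $d$ be an integer with $1\le d\le v/2$; here $d=3$, so $v\ge 6$. The Kneser graph $K(v,3)$ has as vertices the $3$-subsets of $\Omega$, two of them being adjacent when they are disjoint. For a graph on $n$ vertices with adjacency matrix $A$ and part sizes $m_1,\dots,m_k$, the bound $\mathrm{GPP}_{\mathrm m}$ for the minimum graph partition problem (partition the vertex set into $k$ sets of sizes $m_1,\dots,m_k$ minimizing the number of edges joining different sets) is the optimal value of $$\min\ \tfrac12\operatorname{tr}A(J_n-Y)\quad\text{s.t.}\quad \operatorname{diag}(Y)=u_n,\ \ \operatorname{tr}J_nY=\sum_{i=1}^k m_i^2,\ \ kY-J_n\succeq 0,\ \ Y\ge 0\ \text{(entrywise)},$$ over real symmetric $n\times n$ matrices $Y$, where $J_n$ is the all-ones matrix, $u_n$ the all-ones vector, and $\operatorname{diag}(Y)$ the vector of diagonal entries of $Y$. Vector inequalities are componentwise. *)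

theory Defs
  imports "HOL-Analysis.Analysis" "Graph_Theory.Pair_Digraph"
begin

text \<open>Undirected graphs are symmetric digraphs: each edge is a pair of opposite arcs.\<close>

definition kneser_graph :: "'a set \<Rightarrow> nat \<Rightarrow> 'a set pair_pre_digraph" where
  "kneser_graph \<Omega> d =
     \<lparr> pverts = {S. S \<subseteq> \<Omega> \<and> card S = d},
       parcs = {(S, T). S \<subseteq> \<Omega> \<and> card S = d \<and> T \<subseteq> \<Omega> \<and> card T = d \<and> S \<inter> T = {}} \<rparr>"

lemma pair_graph_kneser_graph:
  assumes "finite \<Omega>" and "1 \<le> d"
  shows "pair_graph (kneser_graph \<Omega> d)"
proof
  have fin: "finite (pverts (kneser_graph \<Omega> d))"
    using assms(1) by (simp add: kneser_graph_def)
  have sub: "parcs (kneser_graph \<Omega> d) \<subseteq> pverts (kneser_graph \<Omega> d) \<times> pverts (kneser_graph \<Omega> d)"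
    unfolding kneser_graph_def by auto
  show "finite (pverts (kneser_graph \<Omega> d))" by (rule fin)
  show "finite (parcs (kneser_graph \<Omega> d))"
    by (rule finite_subset[OF sub finite_cartesian_product[OF fin fin]])
  show "fst e \<in> pverts (kneser_graph \<Omega> d)" if "e \<in> parcs (kneser_graph \<Omega> d)" for e
    using subsetD[OF sub that] by (simp add: mem_Times_iff)
  show "snd e \<in> pverts (kneser_graph \<Omega> d)" if "e \<in> parcs (kneser_graph \<Omega> d)" for e
    using subsetD[OF sub that] by (simp add: mem_Times_iff)
  show "fst e \<noteq> snd e" if "e \<in> parcs (kneser_graph \<Omega> d)" for e
  proof
    assume "fst e = snd e"
    from that have card: "card (fst e) = d" and disj: "fst e \<inter> snd e = {}"
      unfolding kneser_graph_def by (simp_all add: split_beta)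
    from disj \<open>fst e = snd e\<close> have "fst e = {}" by (metis Int_absorb)
    with card assms(2) show False by simp
  qed
  have "sym (parcs (kneser_graph \<Omega> d))"
    by (rule symI) (simp add: kneser_graph_def Int_commute)
  then show "symmetric (with_proj (kneser_graph \<Omega> d))"
    unfolding symmetric_def with_proj_simps .
qed

text \<open>
  The rows and columns are indexed by a finite type; \<open>f\<close> labels the indices bijectively by the
  vertices of \<open>G\<close>.
\<close>

definition adjacency_matrix :: "'a pair_pre_digraph \<Rightarrow> ('n \<Rightarrow> 'a) \<Rightarrow> real ^ 'n ^ 'n" where
  "adjacency_matrix G f = (\<chi> i j. if (f i, f j) \<in> parcs G then 1 else 0)"

definition all_ones_matrix :: "real ^ 'n ^ 'n" where
  "all_ones_matrix = (\<chi> i j. 1)"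

definition all_ones_vector :: "real ^ 'n" where
  "all_ones_vector = (\<chi> i. 1)"

definition diag_vector :: "real ^ 'n ^ 'n \<Rightarrow> real ^ 'n" where
  "diag_vector Y = (\<chi> i. Y $ i $ i)"

definition positive_semidefinite :: "real ^ 'n ^ 'n \<Rightarrow> bool" where
  "positive_semidefinite M \<longleftrightarrow> transpose M = M \<and> (\<forall>x. 0 \<le> x \<bullet> (M *v x))"

definition GPPm_feasible :: "nat \<Rightarrow> (nat \<Rightarrow> nat) \<Rightarrow> (real ^ 'n ^ 'n) set" where
  "GPPm_feasible k m =
     {Y. transpose Y = Y \<and>
         diag_vector Y = all_ones_vector \<and>
         trace (all_ones_matrix ** Y) = (\<Sum>i=1..k. (real (m i))\<^sup>2) \<and>
         positive_semidefinite (real k *\<^sub>R Y - all_ones_matrix) \<and>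
         (\<forall>i j. 0 \<le> Y $ i $ j)}"

text \<open>
  The optimal value of a minimization problem is the infimum of the objective over the feasible
  set in the extended reals.
\<close>

definition GPPm :: "real ^ 'n ^ 'n \<Rightarrow> nat \<Rightarrow> (nat \<Rightarrow> nat) \<Rightarrow> ereal" where
  "GPPm A k m =
     (INF Y \<in> GPPm_feasible k m. ereal (1 / 2 * trace (A ** (all_ones_matrix - Y))))"

definition LP_Aeq :: "nat \<Rightarrow> real ^ 3 ^ 1" where
  "LP_Aeq v = vector [vector [3 * real (v - 3),
                              3 * real ((v - 3) choose 2),
                              real ((v - 3) choose 3)]]"

definition LP_Aneq :: "nat \<Rightarrow> real ^ 3 ^ 3" where
  "LP_Aneq v = vector
     [vector [2 * real v - 9, 1 / 2 * ((real v)\<^sup>2 - 13 * real v + 36),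
              1 / 2 * (- (real v)\<^sup>2 + 9 * real v - 20)],
      vector [real v - 7, - 2 * real v + 11, real v - 5],
      vector [- 3, 3, - 1]]"

definition LP_beq :: "nat \<Rightarrow> nat \<Rightarrow> (nat \<Rightarrow> nat) \<Rightarrow> real ^ 1" where
  "LP_beq n k m = vector [1 / real n * (\<Sum>i=1..k. (real (m i))\<^sup>2) - 1]"

definition LP_bneq :: "real ^ 3" where
  "LP_bneq = - vector [1, 1, 1]"

text \<open>The order on \<^typ>\<open>real ^ 3\<close> is componentwise.\<close>

definition LP_feasible :: "nat \<Rightarrow> nat \<Rightarrow> (nat \<Rightarrow> nat) \<Rightarrow> (real ^ 3) set" where
  "LP_feasible v k m =
     {y. LP_Aeq v *v y = LP_beq (v choose 3) k m \<and> LP_Aneq v *v y \<ge> LP_bneq \<and> y \<ge> 0}"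

definition LP_value :: "nat \<Rightarrow> nat \<Rightarrow> (nat \<Rightarrow> nat) \<Rightarrow> ereal" where
  "LP_value v k m =
     (INF y \<in> LP_feasible v k m.
        ereal (1 / 2 * real (v choose 3) * real ((v - 3) choose 3) * (1 - y $ 3)))"

end

theory Submission
  imports Defs
begin

text \<open>
  For every \<open>j\<close>, the projection onto the \<open>j\<close>-th eigenspace of the Johnson scheme \<open>J(v, 3)\<close> is a
  Gram matrix whose entries depend on \<open>card (S \<inter> T)\<close> only. Pairing it with the positive semidefinite
  matrix \<open>k Y - J\<close> shows that the averages of a feasible \<open>Y\<close> over the three non-diagonal relations
  of the scheme satisfy the inequalities of the linear program. Conversely, a feasible point of the
  linear program gives the entries of a matrix \<open>Y\<close> for which \<open>k Y - J\<close> is a combination of the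
  projections with nonnegative coefficients; for the projection onto the constants this
  nonnegativity is the Cauchy-Schwarz inequality for the part sizes.
\<close>

section \<open>Pairing positive semidefinite matrices with Gram matrices\<close>

text \<open>After the sums are exchanged, each \<open>p\<close> contributes the quadratic form of
  \<open>M\<close> at the vector \<open>F p\<close>.\<close>

lemma sum_mult_psd_gram_nonneg:
  fixes M :: "real ^ 'n::finite ^ 'n"
  assumes "positive_semidefinite M"
  shows "0 \<le> (\<Sum>a\<in>UNIV. \<Sum>b\<in>UNIV. (\<Sum>p\<in>P. F p a * F p b) * M $ a $ b)"
proof -
  have "(\<Sum>a\<in>UNIV. \<Sum>b\<in>UNIV. (\<Sum>p\<in>P. F p a * F p b) * M $ a $ b)
      = (\<Sum>a\<in>UNIV. \<Sum>b\<in>UNIV. \<Sum>p\<in>P. F p a * F p b * M $ a $ b)"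
    by (simp add: sum_distrib_right)
  also have "\<dots> = (\<Sum>a\<in>UNIV. \<Sum>p\<in>P. \<Sum>b\<in>UNIV. F p a * F p b * M $ a $ b)"
    by (intro sum.cong refl sum.swap)
  also have "\<dots> = (\<Sum>p\<in>P. \<Sum>a\<in>UNIV. \<Sum>b\<in>UNIV. F p a * F p b * M $ a $ b)"
    by (rule sum.swap)
  also have "\<dots> = (\<Sum>p\<in>P. (\<chi> a. F p a) \<bullet> (M *v (\<chi> a. F p a)))"
    by (simp add: inner_vec_def matrix_vector_mult_def sum_distrib_left mult_ac)
  also have "\<dots> \<ge> 0"
    using assms by (auto simp: positive_semidefinite_def intro!: sum_nonneg)
  finally show ?thesis .
qed

text \<open>The factor \<open>c\<close> absorbs the normalisation: the Gram matrices found below are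
  positive multiples of the matrices \<open>E\<close> of interest.\<close>

lemma sum_mult_psd_scaled_gram_nonneg:
  fixes M :: "real ^ 'n::finite ^ 'n"
  assumes "positive_semidefinite M" and "c > 0"
    and "\<And>a b. (\<Sum>p\<in>P. F p a * F p b) = c * E a b"
  shows "0 \<le> (\<Sum>a\<in>UNIV. \<Sum>b\<in>UNIV. E a b * M $ a $ b)"
proof -
  have "0 \<le> c * (\<Sum>a\<in>UNIV. \<Sum>b\<in>UNIV. E a b * M $ a $ b)"
    using sum_mult_psd_gram_nonneg[OF assms(1), of F P]
    unfolding assms(3) by (simp only: mult.assoc sum_distrib_left)
  with assms(2) show ?thesis by (simp add: zero_le_mult_iff)
qed

text \<open>The quadratic form at \<open>z\<close> is the square of \<open>z \<bullet> x\<close>.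
  Pairing a matrix with this outer product gives its own quadratic form at \<open>x\<close>, so
  bounds on pairings also yield semidefiniteness.\<close>

lemma positive_semidefinite_outer_product:
  fixes x :: "real ^ 'n::finite"
  shows "positive_semidefinite (\<chi> a b. x $ a * x $ b)"
proof -
  have "0 \<le> z \<bullet> ((\<chi> a b. x $ a * x $ b) *v z)" for z
  proof -
    have "z \<bullet> ((\<chi> a b. x $ a * x $ b) *v z) = (z \<bullet> x) * (z \<bullet> x)"
      by (simp add: inner_vec_def matrix_vector_mult_def sum_product)
         (simp add: sum_distrib_left mult_ac)
    then show ?thesis by simp
  qed
  then show ?thesis
    by (simp add: positive_semidefinite_def transpose_def mult.commute)
qed

section \<open>Counting subsets by intersection size\<close>

lemma real_choose_two: "real (n choose 2) = real n * (real n - 1) / 2"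
  by (simp add: binomial_gbinomial gbinomial_prod_rev numeral_2_eq_2 fact_reduce)

lemma real_choose_three: "real (n choose 3) = real n * (real n - 1) * (real n - 2) / 6"
  by (simp add: binomial_gbinomial gbinomial_prod_rev eval_nat_numeral fact_reduce)

text \<open>\<open>T\<close> amounts to independent choices of \<open>S \<inter> T\<close> inside
  \<open>S\<close> and of \<open>T - S\<close> outside it. The bound \<open>s \<le> d\<close> keeps
  the truncated difference \<open>d - s\<close> meaningful.\<close>

lemma card_subsets_Int:
  assumes "finite \<Omega>" "S \<subseteq> \<Omega>" "s \<le> d"
  shows "card {T. T \<subseteq> \<Omega> \<and> card T = d \<and> card (S \<inter> T) = s}
       = (card S choose s) * ((card \<Omega> - card S) choose (d - s))"
proof -
  have finS: "finite S" using assms finite_subset by blast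
  let ?A = "{T. T \<subseteq> \<Omega> \<and> card T = d \<and> card (S \<inter> T) = s}"
  let ?B = "{U. U \<subseteq> S \<and> card U = s} \<times> {W. W \<subseteq> \<Omega> - S \<and> card W = d - s}"
  have "bij_betw (\<lambda>T. (S \<inter> T, T - S)) ?A ?B"
  proof (rule bij_betw_byWitness[where f' = "\<lambda>(U, W). U \<union> W"])
    show "\<forall>T\<in>?A. (case (S \<inter> T, T - S) of (U, W) \<Rightarrow> U \<union> W) = T"
      by auto
    show "\<forall>p\<in>?B. (S \<inter> (case p of (U, W) \<Rightarrow> U \<union> W), (case p of (U, W) \<Rightarrow> U \<union> W) - S) = p"
      by auto
    have "card (T - S) = card T - card (S \<inter> T)" if "T \<subseteq> \<Omega>" for T
      using that assms(1) by (metis card_Diff_subset_Int finite_Int finite_subset inf_commute)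
    then show "(\<lambda>T. (S \<inter> T, T - S)) ` ?A \<subseteq> ?B"
      by auto
    show "(\<lambda>(U, W). U \<union> W) ` ?B \<subseteq> ?A"
    proof clarsimp
      fix U W assume *: "U \<subseteq> S" "W \<subseteq> \<Omega> - S" "s = card U" "card W = d - card U"
      then have "finite U" "finite W" "U \<inter> W = {}" "S \<inter> (U \<union> W) = U"
        using assms finS by (auto intro: finite_subset)
      with * assms show "U \<subseteq> \<Omega> \<and> W \<subseteq> \<Omega> \<and> card (U \<union> W) = d \<and> card (S \<inter> (U \<union> W)) = card U"
        by (auto simp: card_Un_disjoint)
    qed
  qed
  then have "card ?A = card ?B" by (rule bij_betw_same_card)
  also have "\<dots> = (card S choose s) * ((card \<Omega> - card S) choose (d - s))"
    using assms finS by (simp add: card_cartesian_product n_subsets card_Diff_subset)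
  finally show ?thesis .
qed

section \<open>Sums over points, pairs and triples\<close>

lemma sum_Venn:
  fixes g :: "bool \<Rightarrow> bool \<Rightarrow> real"
  assumes "finite \<Omega>" "S \<subseteq> \<Omega>" "T \<subseteq> \<Omega>"
  shows "(\<Sum>c\<in>\<Omega>. g (c \<in> S) (c \<in> T)) =
    real (card (S \<inter> T)) * g True True
    + (real (card S) - real (card (S \<inter> T))) * g True False
    + (real (card T) - real (card (S \<inter> T))) * g False True
    + (real (card \<Omega>) - real (card S) - real (card T) + real (card (S \<inter> T))) * g False False"
proof -
  \<comment> \<open>Inclusion-exclusion: in terms of the indicators of \<open>S\<close>,
    \<open>T\<close> and \<open>S \<inter> T\<close>, the sum becomes a combination of
    cardinalities.\<close>
  have eq: "g (c \<in> S) (c \<in> T) = g False False + of_bool (c \<in> S) * (g True False - g False False)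
     + of_bool (c \<in> T) * (g False True - g False False)
     + of_bool (c \<in> S \<inter> T) * (g True True - g True False - g False True + g False False)" for c
    by auto
  have ind: "(\<Sum>c\<in>\<Omega>. of_bool (c \<in> X) :: real) = card X" if "X \<subseteq> \<Omega>" for X
    using that assms(1) by (simp add: sum.If_cases of_bool_def Int_absorb1)
  have "\<Omega> \<inter> S = S" "\<Omega> \<inter> T = T" "\<Omega> \<inter> (S \<inter> T) = S \<inter> T"
    using assms by auto
  with assms(1) show ?thesis
    unfolding eq
    by (simp add: sum.distrib sum_distrib_right[symmetric] ind del: Int_iff)
       (simp add: algebra_simps)
qed

text \<open>Ordered pairs allow iterated sums over \<open>\<Omega>\<close>. Each 2-subset counts
  twice (each 3-subset six times in \<open>distinct_triples\<close>), which only changes a positive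
  factor of a Gram matrix.\<close>

definition distinct_pairs :: "'a set \<Rightarrow> ('a \<times> 'a) set" where
  "distinct_pairs \<Omega> = (SIGMA a:\<Omega>. \<Omega> - {a})"

definition distinct_triples :: "'a set \<Rightarrow> ('a \<times> 'a \<times> 'a) set" where
  "distinct_triples \<Omega> = (SIGMA a:\<Omega>. SIGMA b:\<Omega> - {a}. \<Omega> - {a, b})"

lemma sum_distinct_pairs:
  fixes g :: "'a \<Rightarrow> 'a \<Rightarrow> real"
  assumes "finite \<Omega>"
  shows "(\<Sum>(a, b)\<in>distinct_pairs \<Omega>. g a b) = (\<Sum>a\<in>\<Omega>. (\<Sum>b\<in>\<Omega>. g a b) - g a a)"
  using assms unfolding distinct_pairs_def
  by (subst sum.Sigma[symmetric]) (auto simp: sum_diff1)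

text \<open>The sum over \<open>c\<close>, corrected for \<open>c = a\<close> and
  \<open>c = b\<close>, is formally extended to \<open>b = a\<close>, and its value there is
  subtracted again; this is why \<open>g a a a\<close> occurs twice.\<close>

lemma sum_distinct_triples:
  fixes g :: "'a \<Rightarrow> 'a \<Rightarrow> 'a \<Rightarrow> real"
  assumes "finite \<Omega>"
  shows "(\<Sum>(a, b, c)\<in>distinct_triples \<Omega>. g a b c) =
    (\<Sum>a\<in>\<Omega>. (\<Sum>b\<in>\<Omega>. (\<Sum>c\<in>\<Omega>. g a b c) - g a b a - g a b b)
       - ((\<Sum>c\<in>\<Omega>. g a a c) - g a a a - g a a a))"
proof -
  have inner: "(\<Sum>c\<in>\<Omega> - {a, b}. g a b c) = (\<Sum>c\<in>\<Omega>. g a b c) - g a b a - g a b b"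
    if "a \<in> \<Omega>" "b \<in> \<Omega> - {a}" for a b
  proof -
    from that have "a \<noteq> b" by auto
    with that assms show ?thesis by (simp add: sum_diff)
  qed
  have "(\<Sum>(a, b, c)\<in>distinct_triples \<Omega>. g a b c)
      = (\<Sum>a\<in>\<Omega>. \<Sum>b\<in>\<Omega> - {a}. \<Sum>c\<in>\<Omega> - {a, b}. g a b c)"
    using assms unfolding distinct_triples_def
    by (simp add: sum.Sigma split_beta)
  also have "\<dots> = (\<Sum>a\<in>\<Omega>. \<Sum>b\<in>\<Omega> - {a}. (\<Sum>c\<in>\<Omega>. g a b c) - g a b a - g a b b)"
    by (intro sum.cong refl inner)
  also have "\<dots> = (\<Sum>a\<in>\<Omega>. (\<Sum>b\<in>\<Omega>. (\<Sum>c\<in>\<Omega>. g a b c) - g a b a - g a b b)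
       - ((\<Sum>c\<in>\<Omega>. g a a c) - g a a a - g a a a))"
    using assms by (simp add: sum_diff1)
  finally show ?thesis .
qed

section \<open>Gram matrices of the Johnson scheme\<close>

text \<open>Up to positive factors, \<open>johnson1\<close>, \<open>johnson2\<close> and \<open>johnson3\<close>, evaluated at
  \<open>card (S \<inter> T)\<close>, are the \<open>(S, T)\<close> entries of the projections onto the nonconstant eigenspaces.\<close>

definition johnson1 :: "real \<Rightarrow> nat \<Rightarrow> real" where
  "johnson1 v s = v * real s - 9"

definition johnson2 :: "real \<Rightarrow> nat \<Rightarrow> real" where
  "johnson2 v s = (if s = 0 then 18 else if s = 1 then - 2 * (2 * v - 11)
     else if s = 2 then (v - 4) * (v - 7) else 3 * (v - 3) * (v - 4))"

definition johnson3 :: "real \<Rightarrow> nat \<Rightarrow> real" where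
  "johnson3 v s = (if s = 0 then - 6 else if s = 1 then 2 * (v - 5)
     else if s = 2 then - (v - 4) * (v - 5) else (v - 3) * (v - 4) * (v - 5))"

text \<open>For two triples with \<open>s\<close> common points among \<open>v\<close> points, the
  four Venn regions have \<open>s\<close>, \<open>3 - s\<close>, \<open>3 - s\<close> and
  \<open>v - 6 + s\<close> points; this is the sum of \<open>g\<close> over all points.\<close>

definition venn_sum :: "real \<Rightarrow> real \<Rightarrow> (bool \<Rightarrow> bool \<Rightarrow> real) \<Rightarrow> real" where
  "venn_sum v s g = s * g True True + (3 - s) * (g True False + g False True)
     + (v - 6 + s) * g False False"

text \<open>For a triple \<open>S\<close>, the sum of \<open>pair_vec v (a \<in> S) (b \<in> S)\<close> over \<open>b \<noteq> a\<close> vanishes for every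
  \<open>a\<close>, which places this function of \<open>{a, b}\<close> in the second eigenspace of \<open>J(v, 2)\<close>.\<close>

definition pair_vec :: "real \<Rightarrow> bool \<Rightarrow> bool \<Rightarrow> real" where
  "pair_vec v p q = (if p then if q then (v - 3) * (v - 4) else - 2 * (v - 4)
     else if q then - 2 * (v - 4) else 6)"

context
  fixes \<Omega> :: "'a set" and S T :: "'a set"
  assumes fin: "finite \<Omega>" and S: "S \<subseteq> \<Omega>" "card S = 3" and T: "T \<subseteq> \<Omega>" "card T = 3"
begin

lemma card_Int_cases:
  obtains "card (S \<inter> T) = 0" | "card (S \<inter> T) = 1" | "card (S \<inter> T) = 2" | "card (S \<inter> T) = 3"
proof -
  have "card (S \<inter> T) \<le> card S"
    using fin S by (intro card_mono) (auto intro: finite_subset)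
  then show ?thesis using that S by (cases "card (S \<inter> T)") force+
qed

lemma sum_Venn_triples:
  "(\<Sum>c\<in>\<Omega>. g (c \<in> S) (c \<in> T)) = venn_sum (card \<Omega>) (card (S \<inter> T)) g"
  using sum_Venn[OF fin S(1) T(1), of g] S T by (simp add: venn_sum_def algebra_simps)

text \<open>The vector attached to \<open>S\<close> is its indicator on the points, scaled by
  \<open>v\<close> and centred: its coordinates sum to zero.\<close>

lemma johnson1_gram:
  "(\<Sum>a\<in>\<Omega>. (real (card \<Omega>) * of_bool (a \<in> S) - 3) * (real (card \<Omega>) * of_bool (a \<in> T) - 3))
   = real (card \<Omega>) * johnson1 (card \<Omega>) (card (S \<inter> T))"
  using sum_Venn_triples[of "\<lambda>p q. (real (card \<Omega>) * of_bool p - 3) * (real (card \<Omega>) * of_bool q - 3)"]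
  by (simp add: johnson1_def venn_sum_def algebra_simps)

text \<open>Summing over \<open>b\<close> and then over \<open>a\<close>, each time by Venn region,
  shows that only the intersection size matters. The subtracted term removes
  \<open>b = a\<close>.\<close>

lemma sum_distinct_pairs_Venn:
  fixes g :: "bool \<Rightarrow> bool \<Rightarrow> bool \<Rightarrow> bool \<Rightarrow> real"
  defines "N \<equiv> venn_sum (card \<Omega>) (card (S \<inter> T))"
  shows "(\<Sum>(a, b)\<in>distinct_pairs \<Omega>. g (a \<in> S) (a \<in> T) (b \<in> S) (b \<in> T))
    = N (\<lambda>p p'. N (\<lambda>q q'. g p p' q q') - g p p' p p')"
proof -
  have "(\<Sum>(a, b)\<in>distinct_pairs \<Omega>. g (a \<in> S) (a \<in> T) (b \<in> S) (b \<in> T))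
    = (\<Sum>a\<in>\<Omega>. N (g (a \<in> S) (a \<in> T)) - g (a \<in> S) (a \<in> T) (a \<in> S) (a \<in> T))"
    unfolding sum_distinct_pairs[OF fin] N_def sum_Venn_triples[of "g _ _"] ..
  also have "\<dots> = N (\<lambda>p p'. N (g p p') - g p p' p p')"
    unfolding N_def
    by (rule sum_Venn_triples[of "\<lambda>p p'. venn_sum (card \<Omega>) (card (S \<inter> T)) (g p p') - g p p' p p'"])
  finally show ?thesis .
qed

lemma sum_distinct_triples_Venn:
  fixes g :: "bool \<Rightarrow> bool \<Rightarrow> bool \<Rightarrow> bool \<Rightarrow> bool \<Rightarrow> bool \<Rightarrow> real"
  defines "N \<equiv> venn_sum (card \<Omega>) (card (S \<inter> T))"
  shows "(\<Sum>(a, b, c)\<in>distinct_triples \<Omega>. g (a \<in> S) (a \<in> T) (b \<in> S) (b \<in> T) (c \<in> S) (c \<in> T))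
    = N (\<lambda>p p'. N (\<lambda>q q'. N (g p p' q q') - g p p' q q' p p' - g p p' q q' q q')
        - (N (g p p' p p') - g p p' p p' p p' - g p p' p p' p p'))" (is "?lhs = ?rhs")
proof -
  \<comment> \<open>The result of summing over \<open>c\<close> alone, which reduces the claim to
    two further Venn sums.\<close>
  define h where "h p p' q q' = N (g p p' q q') - g p p' q q' p p' - g p p' q q' q q'" for p p' q q'
  have "?lhs = (\<Sum>a\<in>\<Omega>. (\<Sum>b\<in>\<Omega>. h (a \<in> S) (a \<in> T) (b \<in> S) (b \<in> T)) - h (a \<in> S) (a \<in> T) (a \<in> S) (a \<in> T))"
    unfolding sum_distinct_triples[OF fin] N_def sum_Venn_triples[of "g _ _ _ _"] h_def ..
  also have "\<dots> = (\<Sum>a\<in>\<Omega>. N (h (a \<in> S) (a \<in> T)) - h (a \<in> S) (a \<in> T) (a \<in> S) (a \<in> T))"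
    unfolding N_def sum_Venn_triples[of "h _ _"] ..
  also have "\<dots> = N (\<lambda>p p'. N (h p p') - h p p' p p')"
    unfolding N_def
    by (rule sum_Venn_triples[of "\<lambda>p p'. venn_sum (card \<Omega>) (card (S \<inter> T)) (h p p') - h p p' p p'"])
  finally show ?thesis unfolding h_def .
qed

lemma johnson2_gram:
  fixes v defines "v \<equiv> real (card \<Omega>)"
  shows "(\<Sum>(a, b)\<in>distinct_pairs \<Omega>. pair_vec v (a \<in> S) (b \<in> S) * pair_vec v (a \<in> T) (b \<in> T))
   = 2 * (v - 1) * (v - 2) * johnson2 v (card (S \<inter> T))"
  unfolding sum_distinct_pairs_Venn[of "\<lambda>p p' q q'. pair_vec v p q * pair_vec v p' q'"] v_def[symmetric]
  \<comment> \<open>Each of the four possible intersection sizes leaves a polynomial identity in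
    \<open>v\<close>.\<close>
  by (cases rule: card_Int_cases; simp add: venn_sum_def pair_vec_def johnson2_def algebra_simps)

text \<open>The vector attached to \<open>S\<close> is its own row of the \<open>johnson3\<close>
  matrix, as the three indicators add up to the size of the intersection of \<open>S\<close> with
  \<open>{a, b, c}\<close>. The identity says that this matrix is idempotent up to scaling; the 6
  counts orderings.\<close>

lemma johnson3_gram:
  fixes v defines "v \<equiv> real (card \<Omega>)"
  shows "(\<Sum>(a, b, c)\<in>distinct_triples \<Omega>.
      johnson3 v (of_bool (a \<in> S) + of_bool (b \<in> S) + of_bool (c \<in> S))
      * johnson3 v (of_bool (a \<in> T) + of_bool (b \<in> T) + of_bool (c \<in> T)))
   = 6 * (v - 2) * (v - 3) * (v - 4) * johnson3 v (card (S \<inter> T))"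
  unfolding v_def[symmetric] sum_distinct_triples_Venn[of "\<lambda>p p' q q' r r'.
    johnson3 v (of_bool p + of_bool q + of_bool r) * johnson3 v (of_bool p' + of_bool q' + of_bool r')"]
  by (cases rule: card_Int_cases; simp add: venn_sum_def johnson3_def algebra_simps)

end

section \<open>Matrices constant on intersection sizes, and the linear program in
  coordinates\<close>

text \<open>The index of \<open>y\<close> is the Johnson distance, so \<open>y $ i\<close> belongs
  to intersection size \<open>3 - i\<close>: disjoint triples, the edges of the Kneser graph, carry
  \<open>y $ 3\<close>.\<close>

definition johnson_class :: "real ^ 3 \<Rightarrow> nat \<Rightarrow> real" where
  "johnson_class y s = (if s = 0 then y $ 3 else if s = 1 then y $ 2 else if s = 2 then y $ 1 else 1)"

lemma johnson_values:
  "johnson1 v s = v * real s - 9" "johnson2 v 0 = 18" "johnson2 v 1 = - 2 * (2 * v - 11)"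
  "johnson2 v 2 = (v - 4) * (v - 7)" "johnson2 v 3 = 3 * (v - 3) * (v - 4)"
  "johnson3 v 0 = - 6" "johnson3 v 1 = 2 * (v - 5)"
  "johnson3 v 2 = - (v - 4) * (v - 5)" "johnson3 v 3 = (v - 3) * (v - 4) * (v - 5)"
  "johnson_class y 0 = y $ 3" "johnson_class y 1 = y $ 2"
  "johnson_class y 2 = y $ 1" "johnson_class y 3 = 1"
  by (simp_all add: johnson1_def johnson2_def johnson3_def johnson_class_def)

text \<open>The coefficients are the multiplicities of the eigenspaces divided by the number of vertices,
  adjusted to the scaling of \<open>johnson1\<close>, \<open>johnson2\<close> and \<open>johnson3\<close>.\<close>

lemma johnson_class_expansion:
  fixes v :: real
  assumes "v \<ge> 6" "s \<le> 3"
  shows "johnson_class y s =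
      6 * (1 + 3 * (v - 3) * y $ 1 + 3 * (v - 3) * (v - 4) / 2 * y $ 2
         + (v - 3) * (v - 4) * (v - 5) / 6 * y $ 3) / (v * (v - 1) * (v - 2))
    + 2 * (1 + (2 * v - 9) * y $ 1 + 1 / 2 * (v\<^sup>2 - 13 * v + 36) * y $ 2
         + 1 / 2 * (- v\<^sup>2 + 9 * v - 20) * y $ 3) / (v * (v - 2) * (v - 3)) * johnson1 v s
    + (1 + (v - 7) * y $ 1 + (- 2 * v + 11) * y $ 2 + (v - 5) * y $ 3)
         / ((v - 1) * (v - 2) * (v - 4)) * johnson2 v s
    + (1 - 3 * y $ 1 + 3 * y $ 2 - y $ 3) / ((v - 2) * (v - 3) * (v - 4)) * johnson3 v s"
proof -
  have nz: "v \<noteq> 0" "v - 1 \<noteq> 0" "v - 2 \<noteq> 0" "v - 3 \<noteq> 0" "v - 4 \<noteq> 0"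
    using assms by auto
  \<comment> \<open>Clearing the common denominator leaves a polynomial identity for each
    intersection size.\<close>
  have eq: "z = a / (v * (v - 1) * (v - 2)) + b / (v * (v - 2) * (v - 3)) * p
      + c / ((v - 1) * (v - 2) * (v - 4)) * q + d / ((v - 2) * (v - 3) * (v - 4)) * t"
    if "z * (v * (v - 1) * (v - 2) * (v - 3) * (v - 4))
      = a * (v - 3) * (v - 4) + b * p * (v - 1) * (v - 4) + c * q * v * (v - 3) + d * t * v * (v - 1)"
    for z a b c d p q t
  proof -
    have "a / (v * (v - 1) * (v - 2)) + b / (v * (v - 2) * (v - 3)) * p
      + c / ((v - 1) * (v - 2) * (v - 4)) * q + d / ((v - 2) * (v - 3) * (v - 4)) * t
      = (a * (v - 3) * (v - 4) + b * p * (v - 1) * (v - 4) + c * q * v * (v - 3) + d * t * v * (v - 1))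
        / (v * (v - 1) * (v - 2) * (v - 3) * (v - 4))"
      using nz by (simp add: divide_simps) (simp add: algebra_simps)
    also have "\<dots> = z" unfolding that[symmetric] using nz by simp
    finally show ?thesis by simp
  qed
  consider "s = 0" | "s = 1" | "s = 2" | "s = 3" using assms(2) by linarith
  then show ?thesis
  proof cases
    case 1
    show ?thesis
      unfolding 1 johnson_values of_nat_0 of_nat_1 of_nat_numeral by (rule eq) algebra
  next
    case 2
    show ?thesis
      unfolding 2 johnson_values of_nat_0 of_nat_1 of_nat_numeral by (rule eq) algebra
  next
    case 3
    show ?thesis
      unfolding 3 johnson_values of_nat_0 of_nat_1 of_nat_numeral by (rule eq) algebra
  next
    case 4
    show ?thesis
      unfolding 4 johnson_values of_nat_0 of_nat_1 of_nat_numeral by (rule eq) algebra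
  qed
qed

text \<open>With the bound -1 moved across, the three inequality rows become the brackets of
  \<open>johnson_class_expansion\<close>; binomials and truncated differences become real
  polynomials.\<close>

lemma LP_feasible_iff:
  assumes "v \<ge> 6"
  shows "y \<in> LP_feasible v k m \<longleftrightarrow>
    3 * (real v - 3) * y $ 1 + 3 * (real v - 3) * (real v - 4) / 2 * y $ 2
      + (real v - 3) * (real v - 4) * (real v - 5) / 6 * y $ 3
      = 1 / real (v choose 3) * (\<Sum>i=1..k. (real (m i))\<^sup>2) - 1
    \<and> 0 \<le> 1 + (2 * real v - 9) * y $ 1 + 1 / 2 * ((real v)\<^sup>2 - 13 * real v + 36) * y $ 2
      + 1 / 2 * (- (real v)\<^sup>2 + 9 * real v - 20) * y $ 3
    \<and> 0 \<le> 1 + (real v - 7) * y $ 1 + (- 2 * real v + 11) * y $ 2 + (real v - 5) * y $ 3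
    \<and> 0 \<le> 1 - 3 * y $ 1 + 3 * y $ 2 - y $ 3
    \<and> 0 \<le> y $ 1 \<and> 0 \<le> y $ 2 \<and> 0 \<le> y $ 3"
proof -
  have "real (v - 3) = real v - 3" using assms by simp
  then show ?thesis
    unfolding LP_feasible_def LP_Aeq_def LP_beq_def LP_Aneq_def LP_bneq_def mem_Collect_eq
      less_eq_vec_def vec_eq_iff forall_3 forall_1 matrix_vector_mult_def real_choose_two real_choose_three
    by (simp add: sum_3 vector_3 vector_1 algebra_simps)
qed

lemma trace_all_ones_mult: "trace (all_ones_matrix ** Y) = (\<Sum>a\<in>UNIV. \<Sum>b\<in>UNIV. Y $ a $ b)"
  unfolding trace_def matrix_matrix_mult_def all_ones_matrix_def
  by simp (rule sum.swap)

section \<open>The Johnson scheme on the matrix indices\<close>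

context
  fixes \<Omega> :: "'a set" and v :: nat and f :: "'n::finite \<Rightarrow> 'a set"
  assumes fin: "finite \<Omega>" and card_\<Omega>: "card \<Omega> = v" and v: "v \<ge> 6"
    and bij: "bij_betw f UNIV (pverts (kneser_graph \<Omega> 3))"
begin

lemma range_f: "range f = {S. S \<subseteq> \<Omega> \<and> card S = 3}"
  using bij by (simp add: bij_betw_def kneser_graph_def)

lemma f_subset: "f a \<subseteq> \<Omega>" and card_f: "card (f a) = 3"
  using range_f by auto

lemma inj_f: "inj f"
  using bij by (simp add: bij_betw_def)

lemma card_index: "CARD('n) = v choose 3"
  using bij_betw_same_card[OF bij] n_subsets[OF fin, of 3] card_\<Omega> by (simp add: kneser_graph_def)

lemma card_Int_le: "card (f a \<inter> f b) \<le> 3"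
  using card_mono[of "f a" "f a \<inter> f b"] card_f[of a] f_subset[of a] fin finite_subset
  by (metis inf_le1)

lemma card_Int_eq_3_iff: "card (f a \<inter> f b) = 3 \<longleftrightarrow> a = b"
proof
  assume *: "card (f a \<inter> f b) = 3"
  have "finite (f a)" "finite (f b)" using f_subset fin finite_subset by blast+
  have "f a \<inter> f b = f a"
    by (rule card_subset_eq) (use \<open>finite (f a)\<close> * card_f in simp_all)
  moreover have "f a \<inter> f b = f b"
    by (rule card_subset_eq) (use \<open>finite (f b)\<close> * card_f in simp_all)
  ultimately show "a = b" using inj_f by (metis injD)
qed (simp add: card_f)

lemma adjacent_iff: "(f a, f b) \<in> parcs (kneser_graph \<Omega> 3) \<longleftrightarrow> card (f a \<inter> f b) = 0"
proof -
  have "finite (f a)" using f_subset fin finite_subset by blast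
  then show ?thesis using f_subset card_f by (simp add: kneser_graph_def)
qed

text \<open>The valency of a relation of the scheme: \<open>f\<close> carries the indices in the row
  of \<open>a\<close> bijectively to the triples counted by \<open>card_subsets_Int\<close>.\<close>

lemma card_row:
  assumes "s \<le> 3"
  shows "card {b. card (f a \<inter> f b) = s} = (3 choose s) * ((v - 3) choose (3 - s))"
proof -
  have "card {b. card (f a \<inter> f b) = s} = card (f ` {b. card (f a \<inter> f b) = s})"
    using inj_f by (metis card_image inj_on_subset subset_UNIV)
  also have "f ` {b. card (f a \<inter> f b) = s} = {T. T \<subseteq> \<Omega> \<and> card T = 3 \<and> card (f a \<inter> T) = s}"
  proof (intro equalityI subsetI)
    fix T assume T: "T \<in> {T. T \<subseteq> \<Omega> \<and> card T = 3 \<and> card (f a \<inter> T) = s}"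
    then have "T \<in> range f" unfolding range_f by simp
    with T show "T \<in> f ` {b. card (f a \<inter> f b) = s}" by auto
  qed (use f_subset card_f in auto)
  also have "card \<dots> = (3 choose s) * ((v - 3) choose (3 - s))"
    using card_subsets_Int[OF fin f_subset assms] by (simp add: card_f card_\<Omega>)
  finally show ?thesis .
qed

text \<open>Relations are named by intersection size. For constant \<open>g = 1\<close> this counts
  the ordered pairs in the relation; for the entries of a matrix it is their total there.\<close>

definition relation_sum :: "('n \<Rightarrow> 'n \<Rightarrow> real) \<Rightarrow> nat \<Rightarrow> real" where
  "relation_sum g s = (\<Sum>a\<in>UNIV. \<Sum>b\<in>UNIV. of_bool (card (f a \<inter> f b) = s) * g a b)"

text \<open>Every pair of indices lies in exactly one of the four relations.\<close>

lemma sum_class_function: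
  "(\<Sum>a\<in>UNIV. \<Sum>b\<in>UNIV. e (card (f a \<inter> f b)) * g a b)
   = e 0 * relation_sum g 0 + e 1 * relation_sum g 1 + e 2 * relation_sum g 2 + e 3 * relation_sum g 3"
proof -
  have "e (card (f a \<inter> f b)) * g a b =
      e 0 * (of_bool (card (f a \<inter> f b) = 0) * g a b) + e 1 * (of_bool (card (f a \<inter> f b) = 1) * g a b)
    + e 2 * (of_bool (card (f a \<inter> f b) = 2) * g a b) + e 3 * (of_bool (card (f a \<inter> f b) = 3) * g a b)"
    for a b
  proof -
    consider "card (f a \<inter> f b) = 0" | "card (f a \<inter> f b) = 1" | "card (f a \<inter> f b) = 2" | "card (f a \<inter> f b) = 3"
      using card_Int_le[of a b] by linarith
    then show ?thesis by cases simp_all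
  qed
  then show ?thesis
    by (simp only: relation_sum_def sum.distrib sum_distrib_left)
qed

lemma relation_sum_3: "relation_sum g 3 = (\<Sum>a\<in>UNIV. g a a)"
proof -
  have "of_bool (card (f a \<inter> f b) = 3) * g a b = (if a = b then g a b else 0)" for a b
    by (simp add: card_Int_eq_3_iff)
  then show ?thesis by (simp add: relation_sum_def)
qed

lemma real_minus_3: "real (v - 3) = real v - 3"
  using v by simp

lemma relation_sum_1:
  "relation_sum (\<lambda>_ _. 1) 0 = real (v choose 3) * real ((v - 3) choose 3)"
  "relation_sum (\<lambda>_ _. 1) 1 = real (v choose 3) * (3 * (real v - 3) * (real v - 4) / 2)"
  "relation_sum (\<lambda>_ _. 1) 2 = real (v choose 3) * (3 * (real v - 3))"
  "relation_sum (\<lambda>_ _. 1) 3 = real (v choose 3)"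
proof -
  have row: "relation_sum (\<lambda>_ _. 1) s
      = real (v choose 3) * (real (3 choose s) * real ((v - 3) choose (3 - s)))" if "s \<le> 3" for s
    using that by (simp add: relation_sum_def card_row card_index sum.If_cases of_bool_def)
  have "3 choose 2 = (3::nat)" "3 choose 1 = (3::nat)"
    by (simp_all add: numeral_eq_Suc)
  then show
    "relation_sum (\<lambda>_ _. 1) 0 = real (v choose 3) * real ((v - 3) choose 3)"
    "relation_sum (\<lambda>_ _. 1) 1 = real (v choose 3) * (3 * (real v - 3) * (real v - 4) / 2)"
    "relation_sum (\<lambda>_ _. 1) 2 = real (v choose 3) * (3 * (real v - 3))"
    "relation_sum (\<lambda>_ _. 1) 3 = real (v choose 3)"
    using row[of 0] row[of 1] row[of 2] row[of 3]
    by (simp_all add: real_choose_two real_minus_3 del: One_nat_def)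
qed

lemma sum_class_function_1:
  "(\<Sum>a\<in>(UNIV::'n set). \<Sum>b\<in>UNIV. e (card (f a \<inter> f b)))
   = real (v choose 3) * (e 3 + 3 * (real v - 3) * e 2 + 3 * (real v - 3) * (real v - 4) / 2 * e 1
      + (real v - 3) * (real v - 4) * (real v - 5) / 6 * e 0)"
proof -
  have V3: "real ((v - 3) choose 3) = (real v - 3) * (real v - 4) * (real v - 5) / 6"
    unfolding real_choose_three real_minus_3 by simp
  let ?n = "real (v choose 3)"
  have "(\<Sum>a\<in>(UNIV::'n set). \<Sum>b\<in>UNIV. e (card (f a \<inter> f b)))
    = e 0 * (?n * ((real v - 3) * (real v - 4) * (real v - 5) / 6))
      + e 1 * (?n * (3 * (real v - 3) * (real v - 4) / 2)) + e 2 * (?n * (3 * (real v - 3))) + e 3 * ?n"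
    using sum_class_function[of e "\<lambda>_ _. 1"] unfolding relation_sum_1 V3 by (simp only: mult_1_right)
  also have "\<dots> = ?n * (e 3 + 3 * (real v - 3) * e 2 + 3 * (real v - 3) * (real v - 4) / 2 * e 1
      + (real v - 3) * (real v - 4) * (real v - 5) / 6 * e 0)"
    by (simp add: distrib_left mult_ac)
  finally show ?thesis .
qed

section \<open>Nonnegative pairings with the eigenspace projections\<close>

text \<open>By \<open>johnson1_gram\<close> the \<open>johnson1\<close> matrix is a Gram matrix up
  to the factor \<open>v\<close>. This and its two analogues serve both directions: \<open>M\<close>
  is \<open>k Y - J\<close> in one and an outer product in the other.\<close>

lemma sum_johnson1_nonneg:
  assumes "positive_semidefinite (M :: real ^ 'n ^ 'n)"
  shows "0 \<le> (\<Sum>a\<in>UNIV. \<Sum>b\<in>UNIV. johnson1 v (card (f a \<inter> f b)) * M $ a $ b)"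
proof (rule sum_mult_psd_scaled_gram_nonneg[OF assms])
  show "real v > 0" using v by simp
  show "(\<Sum>c\<in>\<Omega>. (real v * of_bool (c \<in> f a) - 3) * (real v * of_bool (c \<in> f b) - 3))
    = real v * johnson1 v (card (f a \<inter> f b))" for a b
    using johnson1_gram[OF fin f_subset card_f f_subset card_f] unfolding card_\<Omega> .
qed

lemma sum_johnson2_nonneg:
  assumes "positive_semidefinite (M :: real ^ 'n ^ 'n)"
  shows "0 \<le> (\<Sum>a\<in>UNIV. \<Sum>b\<in>UNIV. johnson2 v (card (f a \<inter> f b)) * M $ a $ b)"
proof (rule sum_mult_psd_scaled_gram_nonneg[OF assms])
  show "2 * (real v - 1) * (real v - 2) > 0" using v by simp
  show "(\<Sum>p\<in>distinct_pairs \<Omega>. (case p of (c, d) \<Rightarrow> pair_vec v (c \<in> f a) (d \<in> f a))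
      * (case p of (c, d) \<Rightarrow> pair_vec v (c \<in> f b) (d \<in> f b)))
    = 2 * (real v - 1) * (real v - 2) * johnson2 v (card (f a \<inter> f b))" for a b
    using johnson2_gram[OF fin f_subset card_f f_subset card_f, of a b] unfolding card_\<Omega>
    by (simp only: case_prod_unfold)
qed

lemma sum_johnson3_nonneg:
  assumes "positive_semidefinite (M :: real ^ 'n ^ 'n)"
  shows "0 \<le> (\<Sum>a\<in>UNIV. \<Sum>b\<in>UNIV. johnson3 v (card (f a \<inter> f b)) * M $ a $ b)"
proof (rule sum_mult_psd_scaled_gram_nonneg[OF assms])
  show "6 * (real v - 2) * (real v - 3) * (real v - 4) > 0" using v by simp
  show "(\<Sum>p\<in>distinct_triples \<Omega>.
      (case p of (c, d, e) \<Rightarrow>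
        johnson3 v (of_bool (c \<in> f a) + of_bool (d \<in> f a) + of_bool (e \<in> f a)))
      * (case p of (c, d, e) \<Rightarrow>
        johnson3 v (of_bool (c \<in> f b) + of_bool (d \<in> f b) + of_bool (e \<in> f b))))
    = 6 * (real v - 2) * (real v - 3) * (real v - 4) * johnson3 v (card (f a \<inter> f b))" for a b
    using johnson3_gram[OF fin f_subset card_f f_subset card_f, of a b] unfolding card_\<Omega>
    by (simp only: case_prod_unfold)
qed

definition class_matrix :: "real ^ 3 \<Rightarrow> real ^ 'n ^ 'n" where
  "class_matrix y = (\<chi> a b. johnson_class y (card (f a \<inter> f b)))"

text \<open>Adjacency is the relation of intersection size 0, so the objective only sees the total
  of \<open>Y\<close> there. Symmetry of \<open>Y\<close> undoes the transposed index order in the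
  trace.\<close>

lemma objective:
  assumes "transpose Y = Y"
  shows "1 / 2 * trace (adjacency_matrix (kneser_graph \<Omega> 3) f ** (all_ones_matrix - Y))
    = 1 / 2 * (real (v choose 3) * real ((v - 3) choose 3) - relation_sum (\<lambda>a b. Y $ a $ b) 0)"
proof -
  have entry_sym: "Y $ b $ a = Y $ a $ b" for a b
    using assms by (simp add: transpose_def vec_eq_iff)
  have "trace (adjacency_matrix (kneser_graph \<Omega> 3) f ** (all_ones_matrix - Y))
     = (\<Sum>a\<in>UNIV. \<Sum>b\<in>UNIV. adjacency_matrix (kneser_graph \<Omega> 3) f $ a $ b
         * (all_ones_matrix - Y) $ b $ a)"
    by (simp add: trace_def matrix_matrix_mult_def)
  also have "\<dots> = (\<Sum>a\<in>UNIV. \<Sum>b\<in>UNIV. of_bool (card (f a \<inter> f b) = 0) * (1 - Y $ a $ b))"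
    by (intro sum.cong refl)
       (simp only: adjacency_matrix_def all_ones_matrix_def adjacent_iff vec_lambda_beta
         vector_minus_component entry_sym of_bool_def)
  also have "\<dots> = relation_sum (\<lambda>_ _. 1) 0 - relation_sum (\<lambda>a b. Y $ a $ b) 0"
    unfolding relation_sum_def by (simp add: sum_subtractf algebra_simps)
  finally show ?thesis using relation_sum_1(1) by simp
qed

section \<open>From feasible matrices to the linear program\<close>

lemma GPPm_feasible_imp_LP_feasible:
  assumes Y: "(Y :: real ^ 'n ^ 'n) \<in> GPPm_feasible k m" and k: "k \<ge> 1"
  obtains y where "y \<in> LP_feasible v k m"
    "1 / 2 * real (v choose 3) * real ((v - 3) choose 3) * (1 - y $ 3)
     = 1 / 2 * trace (adjacency_matrix (kneser_graph \<Omega> 3) f ** (all_ones_matrix - Y))"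
proof -
  \<comment> \<open>\<open>V1\<close>, \<open>V2\<close>, \<open>V3\<close> are the valencies: the
    numbers of triples meeting a given one in 2, 1 and 0 points.\<close>
  define r n V1 V2 V3 where "r = real v" and "n = real (v choose 3)" and "V1 = 3 * (r - 3)"
    and "V2 = 3 * (r - 3) * (r - 4) / 2" and "V3 = (r - 3) * (r - 4) * (r - 5) / 6"
  define R where "R = relation_sum (\<lambda>a b. Y $ a $ b)"
  \<comment> \<open>The averages of \<open>Y\<close> over the three non-diagonal relations.\<close>
  define y :: "real ^ 3" where "y = vector [R 2 / (n * V1), R 1 / (n * V2), R 0 / (n * V3)]"
  have r: "r \<ge> 6" using v by (simp add: r_def)
  have n: "n > 0" using v by (simp add: n_def)
  have V: "V1 > 0" "V2 > 0" "V3 > 0" using r by (simp_all add: V1_def V2_def V3_def)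
  have R: "R 2 = n * V1 * y $ 1" "R 1 = n * V2 * y $ 2" "R 0 = n * V3 * y $ 3"
    using n V by (simp_all add: y_def vector_3)
  have tr: "transpose Y = Y" and diag: "\<And>a. Y $ a $ a = 1"
    and total: "(\<Sum>a\<in>UNIV. \<Sum>b\<in>UNIV. Y $ a $ b) = (\<Sum>i=1..k. (real (m i))\<^sup>2)"
    and psd: "positive_semidefinite (real k *\<^sub>R Y - all_ones_matrix)"
    and nonneg: "\<And>a b. 0 \<le> Y $ a $ b"
    using Y unfolding GPPm_feasible_def trace_all_ones_mult
    by (auto simp: diag_vector_def all_ones_vector_def vec_eq_iff)
  have R3: "R 3 = n"
    unfolding R_def relation_sum_3 by (simp add: diag card_index n_def)
  have "R s \<ge> 0" for s
    unfolding R_def relation_sum_def using nonneg by (intro sum_nonneg) auto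
  then have y0: "0 \<le> y $ 1" "0 \<le> y $ 2" "0 \<le> y $ 3"
    using n V by (simp_all add: y_def vector_3)
  have "(\<Sum>i=1..k. (real (m i))\<^sup>2) = R 0 + R 1 + R 2 + R 3"
    using sum_class_function[of "\<lambda>_. 1" "\<lambda>a b. Y $ a $ b"] total by (simp add: R_def)
  \<comment> \<open>The diagonal contributes \<open>R 3 = n\<close>, which after division by
    \<open>n\<close> is the 1 subtracted on the right.\<close>
  then have eq: "V1 * y $ 1 + V2 * y $ 2 + V3 * y $ 3
      = 1 / n * (\<Sum>i=1..k. (real (m i))\<^sup>2) - 1"
    unfolding R R3 using n by (simp add: field_simps)
  \<comment> \<open>A class function with zero row sums is orthogonal to \<open>J\<close>. Hence
    \<open>J\<close> drops out and the positive factor \<open>k\<close> cancels, which is why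
    \<open>k\<close> is absent from the inequality rows.\<close>
  have ineq: "0 \<le> e 3 + V1 * e 2 * y $ 1 + V2 * e 1 * y $ 2 + V3 * e 0 * y $ 3"
    if pos: "0 \<le> (\<Sum>a\<in>UNIV. \<Sum>b\<in>UNIV. e (card (f a \<inter> f b)) * (real k *\<^sub>R Y - all_ones_matrix) $ a $ b)"
      and zero: "e 3 + V1 * e 2 + V2 * e 1 + V3 * e 0 = 0" for e
  proof -
    have "(\<Sum>a\<in>UNIV. \<Sum>b\<in>UNIV. e (card (f a \<inter> f b)) * (real k *\<^sub>R Y - all_ones_matrix) $ a $ b)
      = real k * (\<Sum>a\<in>UNIV. \<Sum>b\<in>UNIV. e (card (f a \<inter> f b)) * Y $ a $ b)
        - (\<Sum>a\<in>(UNIV::'n set). \<Sum>b\<in>UNIV. e (card (f a \<inter> f b)))"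
      by (simp add: all_ones_matrix_def sum_distrib_left sum_subtractf[symmetric] algebra_simps)
    also have "(\<Sum>a\<in>(UNIV::'n set). \<Sum>b\<in>UNIV. e (card (f a \<inter> f b))) = 0"
      unfolding sum_class_function_1 using zero by (simp add: V1_def V2_def V3_def r_def)
    finally have "0 \<le> real k * (\<Sum>a\<in>UNIV. \<Sum>b\<in>UNIV. e (card (f a \<inter> f b)) * Y $ a $ b)"
      using pos by simp
    then have "0 \<le> (\<Sum>a\<in>UNIV. \<Sum>b\<in>UNIV. e (card (f a \<inter> f b)) * Y $ a $ b)"
      using k by (simp add: zero_le_mult_iff)
    also have "\<dots> = n * (e 3 + V1 * e 2 * y $ 1 + V2 * e 1 * y $ 2 + V3 * e 0 * y $ 3)"
      unfolding sum_class_function[of e "\<lambda>a b. Y $ a $ b"] R_def[symmetric] R R3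
      by (simp add: algebra_simps)
    finally show ?thesis using n by (simp add: zero_le_mult_iff)
  qed
  \<comment> \<open>The leading factor is the diagonal value \<open>johnson1 r 3\<close>; dividing
    by it gives the row constant term 1. The other two rows arise likewise from
    \<open>johnson2 r 3\<close> and \<open>johnson3 r 3\<close>.\<close>
  have "0 \<le> 3 * (r - 3) * (1 + (2 * r - 9) * y $ 1 + 1 / 2 * (r\<^sup>2 - 13 * r + 36) * y $ 2
      + 1 / 2 * (- r\<^sup>2 + 9 * r - 20) * y $ 3)" (is "0 \<le> ?q1")
  proof -
    \<comment> \<open>Row sums vanish because the eigenspace is orthogonal to the constants.\<close>
    have "johnson1 r 3 + V1 * johnson1 r 2 + V2 * johnson1 r 1 + V3 * johnson1 r 0 = 0"
      unfolding johnson_values V1_def V2_def V3_def by simp algebra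
    from ineq[OF sum_johnson1_nonneg[OF psd, folded r_def] this]
    have "0 \<le> johnson1 r 3 + V1 * johnson1 r 2 * y $ 1 + V2 * johnson1 r 1 * y $ 2 + V3 * johnson1 r 0 * y $ 3" .
    also have "\<dots> = ?q1"
      unfolding johnson_values V1_def V2_def V3_def by simp algebra
    finally show ?thesis .
  qed
  then have q1: "0 \<le> 1 + (2 * r - 9) * y $ 1 + 1 / 2 * (r\<^sup>2 - 13 * r + 36) * y $ 2
      + 1 / 2 * (- r\<^sup>2 + 9 * r - 20) * y $ 3"
    using r by (simp add: zero_le_mult_iff)
  have "0 \<le> (3 * (r - 3) * (r - 4)) * (1 + (r - 7) * y $ 1 + (- 2 * r + 11) * y $ 2 + (r - 5) * y $ 3)"
    (is "0 \<le> ?q2")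
  proof -
    have "johnson2 r 3 + V1 * johnson2 r 2 + V2 * johnson2 r 1 + V3 * johnson2 r 0 = 0"
      unfolding johnson_values V1_def V2_def V3_def by algebra
    from ineq[OF sum_johnson2_nonneg[OF psd, folded r_def] this]
    have "0 \<le> johnson2 r 3 + V1 * johnson2 r 2 * y $ 1 + V2 * johnson2 r 1 * y $ 2 + V3 * johnson2 r 0 * y $ 3" .
    also have "\<dots> = ?q2"
      unfolding johnson_values V1_def V2_def V3_def by algebra
    finally show ?thesis .
  qed
  moreover have "0 < 3 * (r - 3) * (r - 4)" using r by simp
  ultimately have q2: "0 \<le> 1 + (r - 7) * y $ 1 + (- 2 * r + 11) * y $ 2 + (r - 5) * y $ 3"
    by (metis zero_le_mult_iff not_le)
  have "0 \<le> ((r - 3) * (r - 4) * (r - 5)) * (1 - 3 * y $ 1 + 3 * y $ 2 - y $ 3)"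
    (is "0 \<le> ?q3")
  proof -
    have "johnson3 r 3 + V1 * johnson3 r 2 + V2 * johnson3 r 1 + V3 * johnson3 r 0 = 0"
      unfolding johnson_values V1_def V2_def V3_def by algebra
    from ineq[OF sum_johnson3_nonneg[OF psd, folded r_def] this]
    have "0 \<le> johnson3 r 3 + V1 * johnson3 r 2 * y $ 1 + V2 * johnson3 r 1 * y $ 2 + V3 * johnson3 r 0 * y $ 3" .
    also have "\<dots> = ?q3"
      unfolding johnson_values V1_def V2_def V3_def by algebra
    finally show ?thesis .
  qed
  moreover have "0 < (r - 3) * (r - 4) * (r - 5)" using r by simp
  ultimately have q3: "0 \<le> 1 - 3 * y $ 1 + 3 * y $ 2 - y $ 3"
    by (metis zero_le_mult_iff not_le)
  show ?thesis
  proof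
    show "y \<in> LP_feasible v k m"
      unfolding LP_feasible_iff[OF v]
      using eq q1 q2 q3 y0 unfolding V1_def V2_def V3_def r_def n_def by blast
    have "real ((v - 3) choose 3) = V3"
      by (simp add: real_choose_three real_minus_3 V3_def r_def)
    then show "1 / 2 * real (v choose 3) * real ((v - 3) choose 3) * (1 - y $ 3)
     = 1 / 2 * trace (adjacency_matrix (kneser_graph \<Omega> 3) f ** (all_ones_matrix - Y))"
      unfolding objective[OF tr] R_def[symmetric] R n_def[symmetric] by (simp add: field_simps)
  qed
qed

section \<open>From the linear program to feasible matrices\<close>

lemma LP_feasible_imp_GPPm_feasible:
  assumes y: "y \<in> LP_feasible v k m" and k: "k \<ge> 1" and m: "(\<Sum>i=1..k. m i) = v choose 3"
  shows "class_matrix y \<in> GPPm_feasible k m"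
    "1 / 2 * trace (adjacency_matrix (kneser_graph \<Omega> 3) f ** (all_ones_matrix - class_matrix y))
     = 1 / 2 * real (v choose 3) * real ((v - 3) choose 3) * (1 - y $ 3)"
proof -
  define r n where "r = real v" and "n = real (v choose 3)"
  have r: "r \<ge> 6" using v by (simp add: r_def)
  have n: "n > 0" using v by (simp add: n_def)
  have n_eq: "n = r * (r - 1) * (r - 2) / 6" by (simp add: n_def r_def real_choose_three)
  \<comment> \<open>\<open>t0\<close>, \<open>t1\<close>, \<open>t2\<close>, \<open>t3\<close> are
    the eigenvalues of \<open>class_matrix y\<close> on the four eigenspaces, with
    \<open>t0\<close>, the row sum, belonging to the constants.\<close>
  define t0 where "t0 = 1 + 3 * (r - 3) * y $ 1 + 3 * (r - 3) * (r - 4) / 2 * y $ 2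
      + (r - 3) * (r - 4) * (r - 5) / 6 * y $ 3"
  define t1 where "t1 = 1 + (2 * r - 9) * y $ 1 + 1 / 2 * (r\<^sup>2 - 13 * r + 36) * y $ 2
      + 1 / 2 * (- r\<^sup>2 + 9 * r - 20) * y $ 3"
  define t2 where "t2 = 1 + (r - 7) * y $ 1 + (- 2 * r + 11) * y $ 2 + (r - 5) * y $ 3"
  define t3 where "t3 = 1 - 3 * y $ 1 + 3 * y $ 2 - y $ 3"
  have t0: "n * t0 = (\<Sum>i=1..k. (real (m i))\<^sup>2)" and t1: "t1 \<ge> 0" and t2: "t2 \<ge> 0" and t3: "t3 \<ge> 0"
    and y0: "0 \<le> y $ 1" "0 \<le> y $ 2" "0 \<le> y $ 3"
    using y n unfolding LP_feasible_iff[OF v] t0_def t1_def t2_def t3_def r_def n_def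
    by (simp_all add: add.assoc)
  have tr: "transpose (class_matrix y) = class_matrix y"
    by (simp add: class_matrix_def transpose_def Int_commute)
  have diag: "class_matrix y $ a $ a = 1" for a
    by (simp add: class_matrix_def card_f johnson_values)
  have nonneg: "0 \<le> class_matrix y $ a $ b" for a b
    using y0 by (simp add: class_matrix_def johnson_class_def)
  have total: "(\<Sum>a\<in>UNIV. \<Sum>b\<in>UNIV. class_matrix y $ a $ b) = (\<Sum>i=1..k. (real (m i))\<^sup>2)"
    unfolding t0[symmetric] class_matrix_def
    by (simp add: sum_class_function_1 johnson_values t0_def n_def r_def algebra_simps
      del: One_nat_def)
  \<comment> \<open>The eigenvalue of \<open>k Y - J\<close> on the constants is
    \<open>k t0 - n\<close>. It is nonnegative by Cauchy-Schwarz, as the part sizes sum to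
    \<open>n\<close>.\<close>
  have "n \<le> real k * t0"
  proof -
    have "n\<^sup>2 = (\<Sum>i=1..k. real (m i))\<^sup>2" by (simp add: n_def m[symmetric])
    also have "\<dots> \<le> real k * (\<Sum>i=1..k. (real (m i))\<^sup>2)"
      using sum_squared_le_sum_of_squares[of "\<lambda>i. real (m i)" "{1..k}"]
      by (simp add: mult.commute)
    also have "\<dots> = n * (real k * t0)" unfolding t0[symmetric] by simp
    finally show ?thesis using n by (simp add: power2_eq_square)
  qed
  then have c0: "0 \<le> real k * t0 / n - 1" using n by (simp add: field_simps)
  define c1 where "c1 = real k * (2 * t1 / (r * (r - 2) * (r - 3)))"
  define c2 where "c2 = real k * (t2 / ((r - 1) * (r - 2) * (r - 4)))"
  define c3 where "c3 = real k * (t3 / ((r - 2) * (r - 3) * (r - 4)))"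
  have c: "c1 \<ge> 0" "c2 \<ge> 0" "c3 \<ge> 0"
    using r t1 t2 t3 by (simp_all add: c1_def c2_def c3_def)
  \<comment> \<open>Subtracting \<open>J\<close> affects only the constant term of the expansion;
    the other coefficients are just multiplied by \<open>k\<close>.\<close>
  have entry: "(real k *\<^sub>R class_matrix y - all_ones_matrix) $ a $ b = (real k * t0 / n - 1)
      + c1 * johnson1 r (card (f a \<inter> f b)) + c2 * johnson2 r (card (f a \<inter> f b))
      + c3 * johnson3 r (card (f a \<inter> f b))" for a b
    using johnson_class_expansion[OF r card_Int_le[of a b], of y]
    unfolding t0_def[symmetric] t1_def[symmetric] t2_def[symmetric] t3_def[symmetric]
    by (simp add: class_matrix_def all_ones_matrix_def c1_def c2_def c3_def n_eq distrib_left mult.assoc)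
  have "0 \<le> x \<bullet> ((real k *\<^sub>R class_matrix y - all_ones_matrix) *v x)" for x
  proof -
    \<comment> \<open>The quadratic form at \<open>x\<close> is the pairing with this outer product,
      so the nonnegativity lemmas apply with \<open>?Z\<close> as the semidefinite matrix.\<close>
    let ?Z = "(\<chi> a b. x $ a * x $ b) :: real ^ 'n ^ 'n"
    have Z: "positive_semidefinite ?Z" by (rule positive_semidefinite_outer_product)
    have "x \<bullet> ((real k *\<^sub>R class_matrix y - all_ones_matrix) *v x)
        = (\<Sum>a\<in>UNIV. \<Sum>b\<in>UNIV. (real k *\<^sub>R class_matrix y - all_ones_matrix) $ a $ b * ?Z $ a $ b)"
      by (simp add: inner_vec_def matrix_vector_mult_def sum_distrib_left mult_ac)
    also have "\<dots> = (real k * t0 / n - 1) * (\<Sum>a\<in>UNIV. \<Sum>b\<in>UNIV. ?Z $ a $ b)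
      + c1 * (\<Sum>a\<in>UNIV. \<Sum>b\<in>UNIV. johnson1 r (card (f a \<inter> f b)) * ?Z $ a $ b)
      + c2 * (\<Sum>a\<in>UNIV. \<Sum>b\<in>UNIV. johnson2 r (card (f a \<inter> f b)) * ?Z $ a $ b)
      + c3 * (\<Sum>a\<in>UNIV. \<Sum>b\<in>UNIV. johnson3 r (card (f a \<inter> f b)) * ?Z $ a $ b)"
      unfolding entry by (simp only: distrib_right sum.distrib sum_distrib_left mult.assoc)
    also have "(\<Sum>a\<in>UNIV. \<Sum>b\<in>UNIV. ?Z $ a $ b) = (\<Sum>a\<in>UNIV. x $ a)\<^sup>2"
      by (simp add: power2_eq_square sum_product)
    finally show ?thesis
      using c0 c sum_johnson1_nonneg[OF Z] sum_johnson2_nonneg[OF Z] sum_johnson3_nonneg[OF Z]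
      unfolding r_def[symmetric] by (simp only: add_nonneg_nonneg mult_nonneg_nonneg zero_le_power2)
  qed
  moreover have "transpose (real k *\<^sub>R class_matrix y - all_ones_matrix)
      = real k *\<^sub>R class_matrix y - all_ones_matrix"
    using tr by (simp add: transpose_def all_ones_matrix_def vec_eq_iff)
  ultimately have "positive_semidefinite (real k *\<^sub>R class_matrix y - all_ones_matrix)"
    by (simp add: positive_semidefinite_def)
  then show "class_matrix y \<in> GPPm_feasible k m"
    using tr diag nonneg total unfolding GPPm_feasible_def trace_all_ones_mult
    by (simp add: diag_vector_def all_ones_vector_def vec_eq_iff)
  have "relation_sum (\<lambda>a b. class_matrix y $ a $ b) 0 = y $ 3 * relation_sum (\<lambda>_ _. 1) 0"
    unfolding relation_sum_def sum_distrib_left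
    by (intro sum.cong refl) (simp add: class_matrix_def johnson_class_def)
  then show "1 / 2 * trace (adjacency_matrix (kneser_graph \<Omega> 3) f ** (all_ones_matrix - class_matrix y))
     = 1 / 2 * real (v choose 3) * real ((v - 3) choose 3) * (1 - y $ 3)"
    unfolding objective[OF tr] by (simp add: relation_sum_1 algebra_simps)
qed

end

theorem theorem4:
  fixes \<Omega> :: "'a set" and v k :: nat and m :: "nat \<Rightarrow> nat"
    and f :: "'n::finite \<Rightarrow> 'a set"
  assumes "finite \<Omega>" and "card \<Omega> = v" and "v \<ge> 6"
    and "bij_betw f UNIV (pverts (kneser_graph \<Omega> 3))"
    and "k \<ge> 1" and "\<And>i. i \<in> {1..k} \<Longrightarrow> m i \<ge> 1"
    and "(\<Sum>i=1..k. m i) = v choose 3"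
  shows "GPPm (adjacency_matrix (kneser_graph \<Omega> 3) f) k m = LP_value v k m"
proof (rule antisym)
  show "GPPm (adjacency_matrix (kneser_graph \<Omega> 3) f) k m \<le> LP_value v k m"
    unfolding GPPm_def LP_value_def
  \<comment> \<open>Every feasible point has a counterpart of the same value on the other side, so
    each infimum bounds the other, also if the feasible sets are empty.\<close>
  proof (rule INF_mono)
    fix y assume "y \<in> LP_feasible v k m"
    note * = LP_feasible_imp_GPPm_feasible[OF assms(1-4) this assms(5,7)]
    show "\<exists>Y\<in>GPPm_feasible k m.
        ereal (1 / 2 * trace (adjacency_matrix (kneser_graph \<Omega> 3) f ** (all_ones_matrix - Y)))
        \<le> ereal (1 / 2 * real (v choose 3) * real ((v - 3) choose 3) * (1 - y $ 3))"
      using *(1) by (rule bexI[rotated]) (simp only: *(2) order.refl)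
  qed
  show "LP_value v k m \<le> GPPm (adjacency_matrix (kneser_graph \<Omega> 3) f) k m"
    unfolding GPPm_def LP_value_def
  proof (rule INF_mono)
    fix Y :: "real ^ 'n ^ 'n" assume "Y \<in> GPPm_feasible k m"
    from GPPm_feasible_imp_LP_feasible[OF assms(1-4) this assms(5)]
    obtain y where *: "y \<in> LP_feasible v k m"
      "1 / 2 * real (v choose 3) * real ((v - 3) choose 3) * (1 - y $ 3)
       = 1 / 2 * trace (adjacency_matrix (kneser_graph \<Omega> 3) f ** (all_ones_matrix - Y))" .
    show "\<exists>y\<in>LP_feasible v k m.
        ereal (1 / 2 * real (v choose 3) * real ((v - 3) choose 3) * (1 - y $ 3))
        \<le> ereal (1 / 2 * trace (adjacency_matrix (kneser_graph \<Omega> 3) f ** (all_ones_matrix - Y)))"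
      using *(1) by (rule bexI[rotated]) (simp only: *(2) order.refl)
  qed
qed

end
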